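(* (a) For every $t\ge 1$, the graph $\overline{tK_2}$ is inversion-free proper $1$-mixed-thin. (b) For all $m,n\ge 1$, the $(m\times n)$-grid is inversion-free proper $3$-mixed-thin. (c) Every tree $T$ is inversion-free proper $3$-mixed-thin.
   Context: Graphs are finite and simple. $\overline{tK_2}$ denotes the complement of the matching with $t$ edges (on $2t$ vertices). The $(m\times n)$-grid is the Cartesian product of a path on $m$ vertices and a path on $n$ vertices: vertex set $\{(a,b):1\le a\le m,\ 1\le b\le n\}$, with $(a,b),(c,d)$ adjacent iff $|a-c|+|b-d|=1$. **Inversion-free proper $k$-mixed-thin.** Let $G=(V,E)$ be a graph, $k>0$ an integer, and $\bar E=\binom{V}{2}\setminus E$. $G$ is *inversion-free proper $k$-mixed-thin* if there exist a partition $(V_1,\ldots,V_k)$ of $V$ and, for each $1\le i\le j\le k$, a linear order $\le_{ij}$ on $V_i\cup V_j$ and a choice of $E_{i,j}\in\{E,\bar E\}$ such that for every $1\le i\le j\le k$ (writing $\lneq_{ij}$ for the strict order): (a') the restriction of $\le_{ij}$ to $V_i$ (resp. to $V_j$) is equal to $\le_{ii}$ (resp. $\le_{jj}$); (b) for every triple $u,v,w$ such that ($\{u,v\}\subseteq V_i$ and $w\in V_j$) or ($\{u,v\}\subseteq V_j$ and $w\in V_i$): if $u\lneq_{ij}v\lneq_{ij}w$ and $uw\in E_{i,j}$, then $vw\in E_{i,j}$; (c) for every triple $u,v,w$ such that ($\{v,w\}\subseteq V_i$ and $u\in V_j$) or ($\{v,w\}\subseteq V_j$ and $u\in V_i$):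 if $u\lneq_{ij}v\lneq_{ij}w$ and $uw\in E_{i,j}$, then $uv\in E_{i,j}$. (Parts of the partition are allowed to be empty.) *)

theory Defs
  imports "Graph_Theory.Graph_Theory" "HOL-Library.Disjoint_Sets"
begin

text \<open>
  A finite simple graph is a \<^locale>\<open>pair_graph\<close>: a finite vertex set with an irreflexive,
  symmetric set of arcs. The undirected edge \<open>uv\<close> is the pair of arcs \<open>(u, v)\<close>, \<open>(v, u)\<close>.
\<close>

definition graph_complement :: "'a pair_pre_digraph \<Rightarrow> 'a pair_pre_digraph" where
  "graph_complement G = \<lparr> pverts = pverts G,
     parcs = {(u, v). u \<in> pverts G \<and> v \<in> pverts G \<and> u \<noteq> v \<and> (u, v) \<notin> parcs G} \<rparr>"

definition matching_graph :: "nat \<Rightarrow> (nat \<times> bool) pair_pre_digraph" where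
  "matching_graph t = \<lparr> pverts = {1..t} \<times> UNIV,
     parcs = {((i, a), (j, b)). i \<in> {1..t} \<and> j \<in> {1..t} \<and> i = j \<and> a \<noteq> b} \<rparr>"

definition grid_graph :: "nat \<Rightarrow> nat \<Rightarrow> (nat \<times> nat) pair_pre_digraph" where
  "grid_graph m n = \<lparr> pverts = {1..m} \<times> {1..n},
     parcs = {((a, b), (c, d)). (a, b) \<in> {1..m} \<times> {1..n} \<and> (c, d) \<in> {1..m} \<times> {1..n} \<and>
       \<bar>int a - int c\<bar> + \<bar>int b - int d\<bar> = 1} \<rparr>"

text \<open>
  The predicate \<^const>\<open>Digraph_Component.tree\<close> does not describe undirected trees: in a symmetric
  digraph every edge gives rise to a directed cycle \<open>u, v, u\<close>. Requiring length at least 3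
  leaves exactly the cycles of the undirected graph.
\<close>

definition undirected_tree :: "'a pair_pre_digraph \<Rightarrow> bool" where
  "undirected_tree T \<longleftrightarrow> pair_graph T \<and> Digraph_Component.connected (with_proj T) \<and>
     \<not> (\<exists>p. pre_digraph.cycle (with_proj T) p \<and> 3 \<le> length p)"

text \<open>
  Below, \<open>V i\<close> are the (possibly empty) parts, \<open>le i j\<close> is the linear order on \<open>V i \<union> V j\<close>
  (as a set of pairs), and \<open>F i j\<close> is the chosen \<open>E\<^sub>i\<^sub>j\<close>. Only the values at
  \<open>1 \<le> i \<le> j \<le> k\<close> matter.
\<close>

definition inversion_free_proper_mixed_thin :: "nat \<Rightarrow> 'a pair_pre_digraph \<Rightarrow> bool" where
  "inversion_free_proper_mixed_thin k G \<longleftrightarrow> 0 < k \<and>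
    (\<exists>(V :: nat \<Rightarrow> 'a set) (le :: nat \<Rightarrow> nat \<Rightarrow> 'a rel) (F :: nat \<Rightarrow> nat \<Rightarrow> 'a rel).
      (\<Union>i\<in>{1..k}. V i) = pverts G \<and> disjoint_family_on V {1..k} \<and>
      (\<forall>i j. 1 \<le> i \<and> i \<le> j \<and> j \<le> k \<longrightarrow>
        linear_order_on (V i \<union> V j) (le i j) \<and>
        F i j \<in> {parcs G, parcs (graph_complement G)} \<and>
        Restr (le i j) (V i) = le i i \<and> Restr (le i j) (V j) = le j j \<and>
        (\<forall>u v w. ({u, v} \<subseteq> V i \<and> w \<in> V j) \<or> ({u, v} \<subseteq> V j \<and> w \<in> V i) \<longrightarrow>
          (u, v) \<in> le i j - Id \<and> (v, w) \<in> le i j - Id \<and> (u, w) \<in> F i j \<longrightarrow> (v, w) \<in> F i j) \<and>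
        (\<forall>u v w. ({v, w} \<subseteq> V i \<and> u \<in> V j) \<or> ({v, w} \<subseteq> V j \<and> u \<in> V i) \<longrightarrow>
          (u, v) \<in> le i j - Id \<and> (v, w) \<in> le i j - Id \<and> (u, w) \<in> F i j \<longrightarrow> (u, v) \<in> F i j)))"

lemma pair_graphI:
  assumes "finite (pverts G)" "parcs G \<subseteq> pverts G \<times> pverts G" "sym (parcs G)" "irrefl (parcs G)"
  shows "pair_graph G"
proof -
  have "finite (parcs G)"
    using assms(1,2) by (meson finite_SigmaI finite_subset)
  with assms show ?thesis
    by unfold_locales (auto simp: symmetric_def irrefl_def)
qed

lemma pair_graph_matching_graph: "pair_graph (matching_graph t)"
  by (rule pair_graphI) (auto simp: matching_graph_def sym_def irrefl_def)

lemma pair_graph_grid_graph: "pair_graph (grid_graph m n)"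
  by (rule pair_graphI) (auto simp: grid_graph_def sym_def irrefl_def)

lemma pair_graph_graph_complement:
  assumes "pair_graph G"
  shows "pair_graph (graph_complement G)"
proof -
  interpret pair_graph G by (fact assms)
  have "sym (parcs G)"
    using pair_sym_arcs by (simp add: symmetric_def)
  then show ?thesis
    using pair_finite_verts by (intro pair_graphI) (auto simp: graph_complement_def sym_def irrefl_def)
qed

end

theory Submission
  imports Defs "HOL-Library.Product_Lexorder" "HOL-Library.List_Lenlexorder"
begin

text \<open>
  For the complement of a matching, take the complement edges and an order in which matched vertices
  are consecutive. Grids and trees are layered, with the layer indices taken modulo 3 as parts: every
  edge either joins neighbours inside a layer (grids only) or joins a vertex \<open>y\<close> to its parent
  in the preceding layer, where the order \<open>f\<close> is such that \<open>f (parent y)\<close> is monotone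
  in \<open>f y\<close>. Two distinct parts always hold cyclically consecutive layers, and listing every
  parent immediately before its children (sorting by \<open>f x\<close> for parents \<open>x\<close> and by
  \<open>f (parent y)\<close> for children \<open>y\<close>) leaves only further children of \<open>x\<close>
  between \<open>x\<close> and its child. In a tree the order is breadth-first: a vertex is coded by the
  path from the root, paths are compared by length and then lexicographically.
\<close>

section \<open>Linear orders from injective keys, and an introduction rule\<close>

definition key_order :: "'a set \<Rightarrow> ('a \<Rightarrow> 'b::linorder) \<Rightarrow> 'a rel" where
  "key_order A k = {(x, y). x \<in> A \<and> y \<in> A \<and> k x \<le> k y}"

lemma linear_order_on_key_order:
  assumes "inj_on k A"
  shows "linear_order_on A (key_order A k)"
  using assms
  by (auto simp: key_order_def order_on_defs refl_on_def trans_def antisym_def total_on_def inj_on_def)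

lemma key_order_strict:
  assumes "inj_on k A"
  shows "(x, y) \<in> key_order A k - Id \<longleftrightarrow> x \<in> A \<and> y \<in> A \<and> k x < k y"
  using assms by (auto simp: key_order_def inj_on_def less_le)

text \<open>Each construction below makes the same choice of edge set for all pairs of parts, so a
  single \<open>F\<close> suffices here.\<close>

lemma inversion_free_proper_mixed_thinI:
  assumes "0 < k" "(\<Union>i\<in>{1..k}. V i) = pverts G" "disjoint_family_on V {1..k}"
    and "\<And>i j. 1 \<le> i \<Longrightarrow> i \<le> j \<Longrightarrow> j \<le> k \<Longrightarrow> linear_order_on (V i \<union> V j) (le i j)"
    and "F \<in> {parcs G, parcs (graph_complement G)}"
    and "\<And>i j. 1 \<le> i \<Longrightarrow> i \<le> j \<Longrightarrow> j \<le> k \<Longrightarrow> Restr (le i j) (V i) = le i i"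
    and "\<And>i j. 1 \<le> i \<Longrightarrow> i \<le> j \<Longrightarrow> j \<le> k \<Longrightarrow> Restr (le i j) (V j) = le j j"
    and "\<And>i j u v w. 1 \<le> i \<Longrightarrow> i \<le> j \<Longrightarrow> j \<le> k \<Longrightarrow>
      {u, v} \<subseteq> V i \<and> w \<in> V j \<or> {u, v} \<subseteq> V j \<and> w \<in> V i \<Longrightarrow>
      (u, v) \<in> le i j - Id \<Longrightarrow> (v, w) \<in> le i j - Id \<Longrightarrow> (u, w) \<in> F \<Longrightarrow> (v, w) \<in> F"
    and "\<And>i j u v w. 1 \<le> i \<Longrightarrow> i \<le> j \<Longrightarrow> j \<le> k \<Longrightarrow>
      {v, w} \<subseteq> V i \<and> u \<in> V j \<or> {v, w} \<subseteq> V j \<and> u \<in> V i \<Longrightarrow>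
      (u, v) \<in> le i j - Id \<Longrightarrow> (v, w) \<in> le i j - Id \<Longrightarrow> (u, w) \<in> F \<Longrightarrow> (u, v) \<in> F"
  shows "inversion_free_proper_mixed_thin k G"
  unfolding inversion_free_proper_mixed_thin_def
proof (rule conjI, fact assms(1), rule exI[of _ V], rule exI[of _ le], rule exI[of _ "\<lambda>_ _. F"],
    intro conjI allI impI; (elim conjE)?)
  show "F \<in> {parcs G, parcs (graph_complement G)}" by (fact assms(5))
qed (fact assms(2,3) | erule (2) assms(4,6,7) | rule assms(8,9), assumption+)+

section \<open>The layering criterion for three parts\<close>

text \<open>
  Here \<open>c\<close> is the layer, \<open>f\<close> the order and \<open>q y\<close> the position of the parent of
  \<open>y\<close>; if \<open>y\<close> has no parent, \<open>q y\<close> is a value not taken by \<open>f\<close>.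
\<close>

lemma mixed_thin_3I:
  fixes G :: "'a pair_pre_digraph" and f q :: "'a \<Rightarrow> 'b::linorder" and c :: "'a \<Rightarrow> nat"
  assumes inj: "inj_on f (pverts G)"
    and mono: "\<And>x y. x \<in> pverts G \<Longrightarrow> y \<in> pverts G \<Longrightarrow> f x \<le> f y \<Longrightarrow> q x \<le> q y"
    and parent: "\<And>x y. x \<in> pverts G \<Longrightarrow> y \<in> pverts G \<Longrightarrow> q y = f x \<Longrightarrow>
      (x, y) \<in> parcs G \<and> (y, x) \<in> parcs G"
    and edge: "\<And>x y. (x, y) \<in> parcs G \<Longrightarrow>
      c x = c y \<and> (\<forall>z\<in>pverts G. \<not> (f x < f z \<and> f z < f y)) \<or>
      c y = Suc (c x) \<and> q y = f x \<or> c x = Suc (c y) \<and> q x = f y"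
  shows "inversion_free_proper_mixed_thin 3 G"
proof -
  \<comment> \<open>Indices run from 1 to 3, so part 3 holds the layers of residue 0.\<close>
  define V where "V i = {x \<in> pverts G. c x mod 3 = i mod 3}" for i
  \<comment> \<open>Membership in the part of the children, among the parts \<open>i\<close> and \<open>j\<close>; never true if \<open>i = j\<close>.\<close>
  define second where "second i j x \<longleftrightarrow> (c x + 2) mod 3 = i mod 3 \<or> (c x + 2) mod 3 = j mod 3"
    for i j x
  \<comment> \<open>The first component moves a child to the position of its parent. As
    \<open>False < True\<close>, the second puts the parent before its children. The third orders
    siblings by \<open>f\<close> and makes the key injective.\<close>
  define key where "key i j x = (if second i j x then q x else f x, second i j x, f x)" for i j x
  define le where "le i j = key_order (V i \<union> V j) (key i j)" for i j
  have inj_key: "inj_on (key i j) (V i \<union> V j)" for i j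
    using inj by (auto simp: inj_on_def key_def V_def)
  have second_eq: "second i j x = second i j y" if "x \<in> V l" "y \<in> V l" for i j l x y
  proof -
    have "c x mod 3 = c y mod 3" using that by (simp add: V_def)
    then have "(c x + 2) mod 3 = (c y + 2) mod 3" by (rule mod_add_cong) simp
    then show ?thesis by (simp add: second_def)
  qed
  have V_sub: "V i \<subseteq> pverts G" for i
    by (auto simp: V_def)
  \<comment> \<open>On one part \<open>second\<close> is constant, so the key begins throughout with
    \<open>f\<close> or throughout with \<open>q\<close>. Since \<open>q\<close> is monotone along
    \<open>f\<close>, both cases order the part by \<open>f\<close>, whatever the other part is.
    This yields condition (a').\<close>
  have key_mono: "key i j x \<le> key i j y \<longleftrightarrow> f x \<le> f y" if "x \<in> V l" "y \<in> V l" for i j l x y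
  proof -
    have G: "x \<in> pverts G" "y \<in> pverts G" using that V_sub by auto
    have "\<not> q x < q y" if "\<not> f x \<le> f y" using mono[OF G(2,1)] that by (meson linear not_le)
    then show ?thesis
      using second_eq[OF that, of i j] mono[OF G] by (auto simp: key_def)
  qed
  have restr: "Restr (le i j) (V l) = le l l" if "l = i \<or> l = j" for i j l
    using that key_mono[of _ l _ i j] key_mono[of _ l _ l l]
    by (auto simp: le_def key_order_def)
  have part_iff: "x \<in> V i \<and> x \<in> V j \<Longrightarrow> i = j" if "i \<in> {1..3}" "j \<in> {1..3}" for i j x
  proof -
    have "i = 1 \<or> i = 2 \<or> i = 3" "j = 1 \<or> j = 2 \<or> j = 3" using that by auto
    then show "x \<in> V i \<and> x \<in> V j \<Longrightarrow> i = j" by (auto simp: V_def)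
  qed
  \<comment> \<open>Both remaining conditions follow from this. Its conclusion places
    \<open>v\<close> with \<open>w\<close>, opposite \<open>u\<close>, in distinct parts: in (b)
    this contradicts disjointness, in (c) the arc \<open>(u, v)\<close> is what is wanted.\<close>
  have main: "i \<noteq> j \<and> (v \<in> V j \<and> w \<in> V j \<and> u \<in> V i \<or> v \<in> V i \<and> w \<in> V i \<and> u \<in> V j) \<and> (u, v) \<in> parcs G"
    if ij: "1 \<le> i" "i \<le> j" "j \<le> 3" and V: "u \<in> V i \<union> V j" "v \<in> V i \<union> V j" "w \<in> V i \<union> V j"
    and same: "u \<in> V i \<and> w \<in> V i \<Longrightarrow> i = j" "u \<in> V j \<and> w \<in> V j \<Longrightarrow> i = j"
    and less: "key i j u < key i j v" "key i j v < key i j w" and uw: "(u, w) \<in> parcs G"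
    for i j u v w
  proof -
    have part: "u \<in> V i \<and> w \<in> V j \<or> u \<in> V j \<and> w \<in> V i"
      using V same by blast
    have G: "u \<in> pverts G" "v \<in> pverts G" "w \<in> pverts G"
      using V V_sub by auto
    have trans: "key i j u < key i j w"
      using less by (rule less_trans)
    have second: "second i j b \<and> \<not> second i j a"
      if "a \<in> V i \<and> b \<in> V j \<or> a \<in> V j \<and> b \<in> V i" "c b = Suc (c a)" for a b
    proof -
      have "(c b + 2) mod 3 = c a mod 3" using that(2) by simp
      moreover have "(c a + 2) mod 3 \<noteq> c a mod 3" "(c a + 2) mod 3 \<noteq> Suc (c a) mod 3"
        by (simp_all add: mod_Suc numeral_2_eq_2)
      ultimately show ?thesis using that by (auto simp: second_def V_def)
    qed
    from edge[OF uw] consider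
      (level) "c u = c w" "\<And>z. z \<in> pverts G \<Longrightarrow> \<not> (f u < f z \<and> f z < f w)"
      | (down) "c w = Suc (c u)" "q w = f u" | (up) "c u = Suc (c w)" "q u = f w"
      by blast
    then show ?thesis
    proof cases
      \<comment> \<open>Equal layers force \<open>i = j\<close>, where the key order is that of
        \<open>f\<close>; but no vertex lies between \<open>u\<close> and \<open>w\<close>
        there.\<close>
      case level
      have "u \<in> V l \<longleftrightarrow> w \<in> V l" for l
        using level(1) G by (simp add: V_def)
      then have "i = j" using part same by blast
      then have "f u < f v" "f v < f w"
        using less key_mono[of v i u i j] key_mono[of w i v i j] V by (simp_all add: not_le[symmetric])
      with level(2) G(2) show ?thesis by blast
    next
      case down
      have w: "second i j w" and u: "\<not> second i j u"
        using second[OF part down(1)] by auto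
      \<comment> \<open>The keys of \<open>u\<close> and \<open>w\<close> start with
        \<open>(f u, False)\<close> and \<open>(f u, True)\<close>. A non-child \<open>v\<close>
        between them would have \<open>f v = f u\<close>, hence the key of \<open>u\<close>
        itself.\<close>
      have v: "second i j v" and "q v = f u"
        using less w u down(2) by (auto simp: key_def split: if_splits)
      then have "(u, v) \<in> parcs G" using parent G by blast
      moreover have "u \<in> V l \<Longrightarrow> v \<notin> V l" for l
        using second_eq u v by blast
      moreover have "i \<noteq> j"
        using part V calculation(2) by blast
      ultimately show ?thesis using V part by blast
    next
      case up
      have "second i j u" "\<not> second i j w"
        using second[of w u] part up(1) by auto
      \<comment> \<open>Here \<open>w\<close> is the parent of \<open>u\<close> and so precedes it,
        against \<open>trans\<close>.\<close>
      then show ?thesis using trans up(2) by (simp add: key_def)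
    qed
  qed
  show ?thesis
  proof (rule inversion_free_proper_mixed_thinI[where V = V and le = le and F = "parcs G"])
    show "(\<Union>i\<in>{1..3}. V i) = pverts G"
    proof
      show "pverts G \<subseteq> (\<Union>i\<in>{1..3}. V i)"
      proof
        fix x assume "x \<in> pverts G"
        moreover have "c x mod 3 < 3" by simp
        then have "c x mod 3 = 1 \<or> c x mod 3 = 2 \<or> c x mod 3 = 0" by linarith
        ultimately have "x \<in> V 1 \<or> x \<in> V 2 \<or> x \<in> V 3" by (auto simp: V_def)
        then show "x \<in> (\<Union>i\<in>{1..3}. V i)" by (elim disjE) (auto intro: bexI[rotated])
      qed
    qed (auto simp: V_def)
    show "disjoint_family_on V {1..3}"
      unfolding disjoint_family_on_def using part_iff by blast
    show "linear_order_on (V i \<union> V j) (le i j)" for i j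
      unfolding le_def by (rule linear_order_on_key_order[OF inj_key])
    show "(v, w) \<in> parcs G"
      if "1 \<le> i" "i \<le> j" "j \<le> 3" "{u, v} \<subseteq> V i \<and> w \<in> V j \<or> {u, v} \<subseteq> V j \<and> w \<in> V i"
        "(u, v) \<in> le i j - Id" "(v, w) \<in> le i j - Id" "(u, w) \<in> parcs G" for i j u v w
    proof -
      have disj: "x \<in> V i \<Longrightarrow> x \<in> V j \<Longrightarrow> i = j" for x
        using part_iff[of i j] that(1-3) by auto
      have V: "u \<in> V i \<union> V j" "v \<in> V i \<union> V j" "w \<in> V i \<union> V j"
        using that(4) by auto
      have same: "u \<in> V i \<and> w \<in> V i \<Longrightarrow> i = j" "u \<in> V j \<and> w \<in> V j \<Longrightarrow> i = j"
        using that(4) disj by blast+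
      have less: "key i j u < key i j v" "key i j v < key i j w"
        using that(5,6) unfolding le_def key_order_strict[OF inj_key] by blast+
      show ?thesis
        using main[OF that(1-3) V same less that(7)] that(4) disj by blast
    qed
    show "(u, v) \<in> parcs G"
      if "1 \<le> i" "i \<le> j" "j \<le> 3" "{v, w} \<subseteq> V i \<and> u \<in> V j \<or> {v, w} \<subseteq> V j \<and> u \<in> V i"
        "(u, v) \<in> le i j - Id" "(v, w) \<in> le i j - Id" "(u, w) \<in> parcs G" for i j u v w
    proof -
      have disj: "x \<in> V i \<Longrightarrow> x \<in> V j \<Longrightarrow> i = j" for x
        using part_iff[of i j] that(1-3) by auto
      have V: "u \<in> V i \<union> V j" "v \<in> V i \<union> V j" "w \<in> V i \<union> V j"
        using that(4) by auto
      have same: "u \<in> V i \<and> w \<in> V i \<Longrightarrow> i = j" "u \<in> V j \<and> w \<in> V j \<Longrightarrow> i = j"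
        using that(4) disj by blast+
      have less: "key i j u < key i j v" "key i j v < key i j w"
        using that(5,6) unfolding le_def key_order_strict[OF inj_key] by blast+
      show ?thesis
        using main[OF that(1-3) V same less that(7)] that(4) disj by blast
    qed
  qed (simp_all add: restr)
qed

section \<open>Complements of matchings, and grids\<close>

lemma mixed_thin_matching_complement:
  "inversion_free_proper_mixed_thin 1 (graph_complement (matching_graph t))"
proof -
  define G where "G = graph_complement (matching_graph t)"
  define le where "le = key_order (pverts G) id"
  define F where "F = parcs (graph_complement G)"
  \<comment> \<open>Arcs in \<open>F\<close> are the matching edges, and lexicographically nothing
    fits between \<open>(i, False)\<close> and \<open>(i, True)\<close>. Conditions (b) and (c) are
    therefore vacuous.\<close>
  have no_between: "\<not> ((u, v) \<in> le - Id \<and> (v, w) \<in> le - Id \<and> (u, w) \<in> F)" for u v w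
    by (auto simp: G_def le_def F_def key_order_def graph_complement_def matching_graph_def)
  have order: "linear_order_on (pverts G \<union> pverts G) le"
    unfolding le_def by (simp add: linear_order_on_key_order)
  have restr: "Restr le (pverts G) = le"
    by (auto simp: le_def key_order_def)
  show ?thesis
    unfolding G_def[symmetric]
  proof (rule inversion_free_proper_mixed_thinI[where V = "\<lambda>_. pverts G" and le = "\<lambda>_ _. le" and F = F])
    show "F \<in> {parcs G, parcs (graph_complement G)}"
      by (simp add: F_def)
    show "disjoint_family_on (\<lambda>_. pverts G) {1..1::nat}"
      by (simp add: disjoint_family_on_def)
    show "(\<Union>i\<in>{1..1::nat}. pverts G) = pverts G"
      by simp
    show "(v, w) \<in> F"
      if "(u, v) \<in> le - Id" "(v, w) \<in> le - Id" "(u, w) \<in> F" for u v w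
      using no_between[of u v w] that by (elim notE) (intro conjI)
    show "(u, v) \<in> F"
      if "(u, v) \<in> le - Id" "(v, w) \<in> le - Id" "(u, w) \<in> F" for u v w
      using no_between[of u v w] that by (elim notE) (intro conjI)
  qed (rule order restr zero_less_one)+
qed

text \<open>Layers are the rows of constant second coordinate, read one after another. Subtracting
  \<open>m\<close> moves to the same column of the preceding row. In row 1 it gives
  \<open>a\<close>, at most \<open>m\<close>, whereas \<open>f\<close> exceeds \<open>m\<close> on
  all vertices, so that row has no parents.\<close>

lemma mixed_thin_grid: "inversion_free_proper_mixed_thin 3 (grid_graph m n)"
proof (rule mixed_thin_3I[where f = "\<lambda>(a, b). b * m + a" and q = "\<lambda>(a, b). b * m + a - m" and c = snd])
  have row: "b = d \<and> a = e" if "b * m + a = d * m + e" "1 \<le> a" "a \<le> m" "1 \<le> e" "e \<le> m" for a b d e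
  proof -
    \<comment> \<open>Lowering the column by 1 turns it into a remainder below \<open>m\<close>, so
      division recovers the row.\<close>
    have "(k * m + r) div m = k" if "r < m" for k r
      using that by simp
    from this[of "a - 1" b] this[of "e - 1" d]
    have "(b * m + (a - 1)) div m = b" "(d * m + (e - 1)) div m = d"
      using that by linarith+
    moreover have "b * m + (a - 1) = d * m + (e - 1)"
      using that by linarith
    ultimately have "b = d" by simp
    then show ?thesis using that by simp
  qed
  show "inj_on (\<lambda>(a, b). b * m + a) (pverts (grid_graph m n))"
  proof (rule inj_onI)
    fix x y
    assume V: "x \<in> pverts (grid_graph m n)" "y \<in> pverts (grid_graph m n)"
      and eq: "(case x of (a, b) \<Rightarrow> b * m + a) = (case y of (a, b) \<Rightarrow> b * m + a)"
    have "snd x = snd y \<and> fst x = fst y"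
      using V eq by (intro row) (auto simp: grid_graph_def)
    then show "x = y" by (simp add: prod_eq_iff)
  qed
  show "(x, y) \<in> parcs (grid_graph m n) \<and> (y, x) \<in> parcs (grid_graph m n)"
    if V: "x \<in> pverts (grid_graph m n)" "y \<in> pverts (grid_graph m n)"
    and eq: "(case y of (a, b) \<Rightarrow> b * m + a - m) = (case x of (a, b) \<Rightarrow> b * m + a)" for x y
  proof -
    obtain a b a' b' where xy: "x = (a, b)" "y = (a', b')" by fastforce
    have "b' * m + a' - m = (b' - 1) * m + a'"
      using V xy by (cases b') (auto simp: grid_graph_def)
    \<comment> \<open>The row \<open>b' - 1\<close> could be the fictitious row 0, which
      \<open>row\<close> admits; it is then excluded because \<open>b\<close> is at least 1.\<close>
    then have "b' - 1 = b \<and> a' = a"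
      using V eq xy by (intro row) (auto simp: grid_graph_def)
    then show ?thesis using V xy by (auto simp: grid_graph_def)
  qed
  show "snd x = snd y \<and> (\<forall>z\<in>pverts (grid_graph m n).
            \<not> ((case x of (a, b) \<Rightarrow> b * m + a) < (case z of (a, b) \<Rightarrow> b * m + a) \<and>
               (case z of (a, b) \<Rightarrow> b * m + a) < (case y of (a, b) \<Rightarrow> b * m + a))) \<or>
        snd y = Suc (snd x) \<and> (case y of (a, b) \<Rightarrow> b * m + a - m) = (case x of (a, b) \<Rightarrow> b * m + a) \<or>
        snd x = Suc (snd y) \<and> (case x of (a, b) \<Rightarrow> b * m + a - m) = (case y of (a, b) \<Rightarrow> b * m + a)"
    if "(x, y) \<in> parcs (grid_graph m n)" for x y
  proof -
    obtain a b a' b' where xy: "x = (a, b)" "y = (a', b')" by fastforce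
    have "\<bar>int a - int a'\<bar> + \<bar>int b - int b'\<bar> = 1"
      using that xy by (auto simp: grid_graph_def)
    then consider "b = b'" "a' = a + 1 \<or> a = a' + 1" | "a = a'" "b' = Suc b" | "a = a'" "b = Suc b'"
      by linarith
    then show ?thesis
      using xy by cases auto
  qed
qed (auto simp: grid_graph_def)

section \<open>Trees: coding vertices by paths from a root\<close>

lemma butlast_mono_lenlex:
  fixes xs ys :: "'a::linorder list"
  assumes "xs \<le> ys"
  shows "butlast xs \<le> butlast ys"
proof (rule ccontr)
  assume "\<not> butlast xs \<le> butlast ys"
  then have less: "butlast ys < butlast xs" by simp
  then have "xs \<noteq> []" by (auto simp: list_less_def)
  then have xs: "xs = butlast xs @ [last xs]" by simp
  \<comment> \<open>Appending one entry to each of two lists preserves a strict length-lexicographic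
    comparison.\<close>
  have "ys < xs"
  proof (cases "ys = []")
    case True
    then show ?thesis using \<open>xs \<noteq> []\<close> by (simp add: list_less_def)
  next
    case False
    then have "(butlast ys @ [last ys], butlast xs @ [last xs]) \<in> lenlex {(u, v). u < v}"
      using less unfolding list_less_def by (intro lenlex_append1) auto
    then show ?thesis
      using False xs by (simp add: list_less_def)
  qed
  then show False using assms by simp
qed

context pair_graph
begin

lemma arc_sym: "(x, y) \<in> parcs G \<Longrightarrow> (y, x) \<in> parcs G"
  using pair_sym_arcs by (auto simp: symmetric_def sym_def)

definition apath_in :: "'a set \<Rightarrow> 'a \<Rightarrow> 'a \<Rightarrow> bool" where
  "apath_in S x y \<longleftrightarrow> (\<exists>p. apath x p y \<and> set (pawalk_verts x p) \<subseteq> S)"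

text \<open>The intended \<open>f x\<close> lists the \<open>g\<close>-labels on the path from the
  root to \<open>x\<close>, so \<open>butlast\<close> gives the code of the parent. Codes are
  nonempty, so \<open>butlast\<close> of a one-entry root code is no code at all.\<close>

definition path_code :: "('a \<Rightarrow> nat) \<Rightarrow> 'a set \<Rightarrow> ('a \<Rightarrow> nat list) \<Rightarrow> bool" where
  "path_code g S f \<longleftrightarrow> (\<forall>x\<in>S. f x \<noteq> [] \<and> last (f x) = g x \<and> set (f x) \<subseteq> g ` S) \<and>
     (\<forall>x\<in>S. \<forall>y\<in>S. (x, y) \<in> parcs G \<longrightarrow> butlast (f y) = f x \<or> butlast (f x) = f y) \<and>
     (\<forall>x\<in>S. \<forall>y\<in>S. butlast (f y) = f x \<longrightarrow> (x, y) \<in> parcs G)"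

lemma apath_in_snoc:
  assumes "apath_in S x z" "(z, y) \<in> parcs G" "y \<notin> S"
  shows "apath_in (insert y S) x y"
proof -
  obtain p where p: "apath x p z" "set (pawalk_verts x p) \<subseteq> S"
    using assms(1) by (auto simp: apath_in_def)
  have last: "last (pawalk_verts x p) = z"
    using p by (auto simp: apath_def)
  have y: "y \<in> pverts G" using assms(2) in_arcsD2 by blast
  have "awalk x (p @ [(z, y)]) y"
    using p last y assms(2) by (auto simp: apath_def awalk_simps)
  moreover have "pawalk_verts x (p @ [(z, y)]) = pawalk_verts x p @ [y]"
    using awalk_verts_append[OF calculation] last by simp
  ultimately have "apath x (p @ [(z, y)]) y"
    using p assms(3) by (auto simp: apath_def)
  then show "apath_in (insert y S) x y"
    unfolding apath_in_def using p \<open>pawalk_verts x (p @ [(z, y)]) = _\<close>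
    by (intro exI[of _ "p @ [(z, y)]"]) auto
qed

lemma apath_in_Cons:
  assumes "apath_in S z x" "(y, z) \<in> parcs G" "y \<notin> S"
  shows "apath_in (insert y S) y x"
proof -
  obtain p where "apath z p x" "set (pawalk_verts z p) \<subseteq> S"
    using assms(1) by (auto simp: apath_in_def)
  then show ?thesis
    unfolding apath_in_def using assms(2,3)
    by (intro exI[of _ "(y, z) # p"]) (auto simp: apath_Cons_iff)
qed

text \<open>Two distinct neighbours of \<open>y\<close> would close the path inside \<open>S\<close>
  to a cycle through \<open>y\<close>. The path then has at least one arc, so the cycle has length
  at least 3.\<close>

lemma unique_neighbour:
  assumes acyclic: "\<not> (\<exists>p. cycle p \<and> 3 \<le> length p)"
    and path: "apath_in S x z" and "y \<notin> S" "(y, x) \<in> parcs G" "(z, y) \<in> parcs G"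
  shows "x = z"
proof (rule ccontr)
  assume "x \<noteq> z"
  obtain p where p: "apath x p z" "set (pawalk_verts x p) \<subseteq> S"
    using path by (auto simp: apath_in_def)
  have last: "last (pawalk_verts x p) = z"
    using p by (auto simp: apath_def)
  have y: "y \<in> pverts G" using assms(5) in_arcsD2 by blast
  have walk: "awalk x (p @ [(z, y)]) y"
    using p last y assms(5) by (auto simp: apath_def awalk_simps)
  moreover have verts: "pawalk_verts x (p @ [(z, y)]) = pawalk_verts x p @ [y]"
    using awalk_verts_append[OF walk] last by simp
  ultimately have "cycle ((y, x) # p @ [(z, y)])"
    using p assms(3,4) unfolding cycle_def
    by (intro exI[of _ y]) (auto simp: apath_def awalk_Cons_iff)
  moreover have "p \<noteq> []"
    using p \<open>x \<noteq> z\<close> by (auto simp: apath_def)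
  then have "3 \<le> length ((y, x) # p @ [(z, y)])"
    by (cases p) auto
  ultimately show False using acyclic by blast
qed

lemma arc_leaving:
  assumes "x \<rightarrow>\<^sup>*\<^bsub>with_proj G\<^esub> z" "x \<in> S" "z \<notin> S"
  obtains a b where "a \<in> S" "b \<notin> S" "(a, b) \<in> parcs G"
proof -
  have "z \<in> S \<or> (\<exists>a\<in>S. \<exists>b. b \<notin> S \<and> (a, b) \<in> parcs G)"
    using assms(1,2) by (induction rule: reachable_induct) auto
  then show thesis using assms(3) that by blast
qed

text \<open>Freshness of \<open>g y\<close> is what keeps the new code from being the parent code of an old vertex.\<close>

lemma path_code_extend:
  assumes code: "path_code g S f" and g: "inj_on g (insert y S)"
    and y: "y \<notin> S" "z \<in> S" "(z, y) \<in> parcs G"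
    and unique: "\<And>x. x \<in> S \<Longrightarrow> (x, y) \<in> parcs G \<Longrightarrow> x = z"
  shows "path_code g (insert y S) (f(y := f z @ [g y]))"
proof -
  have ne: "f x \<noteq> []" and last: "last (f x) = g x" and sub: "set (f x) \<subseteq> g ` S" if "x \<in> S" for x
    using code that by (auto simp: path_code_def)
  have inj: "x = x'" if "f x = f x'" "x \<in> S" "x' \<in> S" for x x'
    using that last g by (metis inj_on_insert inj_on_def)
  have fresh: "butlast (f x) \<noteq> f z @ [g y]" if "x \<in> S" for x
  proof
    assume "butlast (f x) = f z @ [g y]"
    then have "g y \<in> set (f x)" by (metis in_set_butlastD in_set_conv_decomp)
    then show False using sub[OF that] g y(1) by auto
  qed
  have irr: "(y, y) \<notin> parcs G" using pair_no_loops by fastforce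
  show ?thesis
    unfolding path_code_def
  proof (intro conjI ballI impI)
    fix x x' assume xx: "x \<in> insert y S" "x' \<in> insert y S"
    {
      assume "(x, x') \<in> parcs G"
      \<comment> \<open>By \<open>unique\<close> and symmetry, an arc between \<open>y\<close> and
        \<open>S\<close> has \<open>z\<close> as its other end, and \<open>butlast\<close> of the
        new code is \<open>f z\<close>.\<close>
      then show "butlast ((f(y := f z @ [g y])) x') = (f(y := f z @ [g y])) x \<or>
          butlast ((f(y := f z @ [g y])) x) = (f(y := f z @ [g y])) x'"
        using xx code irr unique[of x] unique[of x'] arc_sym[of x x'] y(1)
        by (auto simp: path_code_def)
    next
      assume "butlast ((f(y := f z @ [g y])) x') = (f(y := f z @ [g y])) x"
      \<comment> \<open>If \<open>x'\<close> is the new vertex, \<open>inj\<close> gives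
        \<open>x = z\<close>; if \<open>x\<close> is new and \<open>x'\<close> is old,
        \<open>fresh\<close> gives a contradiction.\<close>
      then show "(x, x') \<in> parcs G"
        using xx code y fresh[of x'] inj[of x z]
        by (auto simp: path_code_def split: if_splits)
    }
  qed (use ne last sub y in \<open>auto split: if_splits\<close>)
qed

text \<open>A maximal coded set, with paths inside it between all its vertices, is everything:
  otherwise some arc leaves it, \<open>unique_neighbour\<close> shows that the new endpoint has one
  neighbour in the set, and \<open>path_code_extend\<close> enlarges it.\<close>

lemma path_code_exists:
  assumes connected: "\<And>x y. x \<in> pverts G \<Longrightarrow> y \<in> pverts G \<Longrightarrow> x \<rightarrow>\<^sup>*\<^bsub>with_proj G\<^esub> y"
    and acyclic: "\<not> (\<exists>p. cycle p \<and> 3 \<le> length p)"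
    and g: "inj_on g (pverts G)" and ne: "pverts G \<noteq> {}"
  shows "\<exists>f. path_code g (pverts G) f"
proof -
  define good where "good S \<longleftrightarrow> S \<subseteq> pverts G \<and> S \<noteq> {} \<and> (\<exists>f. path_code g S f) \<and>
    (\<forall>x\<in>S. \<forall>y\<in>S. apath_in S x y)" for S
  obtain r where r: "r \<in> pverts G" using ne by auto
  have "(r, r) \<notin> parcs G" using pair_no_loops by fastforce
  then have "path_code g {r} (\<lambda>x. [g x])" by (auto simp: path_code_def)
  moreover have single: "apath_in (insert y S) y y" if "y \<in> pverts G" for y S
    using that by (auto simp: apath_in_def apath_Nil_iff intro!: exI[of _ "[]"])
  ultimately have "good {r}" using r by (auto simp: good_def)
  moreover have "finite {S. good S}"
    by (rule finite_subset[of _ "Pow (pverts G)"]) (auto simp: good_def)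
  ultimately obtain S where S: "good S" and max: "\<And>S'. good S' \<Longrightarrow> S \<subseteq> S' \<Longrightarrow> S' = S"
    using finite_has_maximal[of "{S. good S}"] by (metis empty_iff mem_Collect_eq)
  have "S = pverts G"
  proof (rule ccontr)
    assume "S \<noteq> pverts G"
    then obtain x v where "x \<in> S" "x \<in> pverts G" "v \<in> pverts G" "v \<notin> S"
      using S by (auto simp: good_def)
    then obtain z y where y: "z \<in> S" "y \<notin> S" "(z, y) \<in> parcs G"
      using arc_leaving[OF connected] by metis
    have yG: "y \<in> pverts G" using y in_arcsD2 by blast
    obtain f where f: "path_code g S f" using S by (auto simp: good_def)
    have "x = z" if "x \<in> S" "(x, y) \<in> parcs G" for x
      using unique_neighbour[OF acyclic _ y(2) arc_sym[OF that(2)] y(3)] S y that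
      by (auto simp: good_def)
    moreover have "inj_on g (insert y S)"
      using S yG by (intro inj_on_subset[OF g]) (auto simp: good_def)
    ultimately have "\<exists>f. path_code g (insert y S) f"
      using path_code_extend[OF f _ y(2,1,3)] by blast
    moreover have "apath_in (insert y S) a b" if "a \<in> insert y S" "b \<in> insert y S" for a b
    proof -
      have "apath_in (insert y S) a b" if "a \<in> S" "b \<in> S"
        using S that unfolding good_def apath_in_def by (meson subset_insertI2)
      moreover have "apath_in (insert y S) a y" if "a \<in> S"
        using S that y by (intro apath_in_snoc) (auto simp: good_def)
      moreover have "apath_in (insert y S) y b" if "b \<in> S"
        using S that y arc_sym by (intro apath_in_Cons[of _ z]) (auto simp: good_def)
      ultimately show ?thesis using that single[OF yG] by blast
    qed
    ultimately have "good (insert y S)"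
      using S yG unfolding good_def by blast
    then show False using max y by blast
  qed
  then show ?thesis using S by (auto simp: good_def)
qed

end

lemma mixed_thin_tree:
  assumes "undirected_tree T"
  shows "inversion_free_proper_mixed_thin 3 T"
proof -
  interpret pair_graph T using assms by (simp add: undirected_tree_def)
  have "strongly_connected (with_proj T)"
    using assms pair_sym_arcs
    by (intro symmetric_connected_imp_strongly_connected) (auto simp: undirected_tree_def)
  then have ne: "pverts T \<noteq> {}"
    and reach: "\<And>x y. x \<in> pverts T \<Longrightarrow> y \<in> pverts T \<Longrightarrow> x \<rightarrow>\<^sup>*\<^bsub>with_proj T\<^esub> y"
    by (auto simp: strongly_connected_def)
  \<comment> \<open>The vertex type carries no order; numbering makes the codes lists of naturals,
    which can be compared.\<close>
  obtain g :: "'a \<Rightarrow> nat" where g: "inj_on g (pverts T)"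
    using finite_imp_inj_to_nat_seg[OF pair_finite_verts] by blast
  obtain f where f: "path_code g (pverts T) f"
    using path_code_exists[OF reach _ g ne] assms by (auto simp: undirected_tree_def)
  then have code: "f x \<noteq> []" "last (f x) = g x" if "x \<in> pverts T" for x
    using that by (auto simp: path_code_def)
  have len: "length (f x) = Suc (length (butlast (f x)))" if "x \<in> pverts T" for x
    using code[OF that] by (cases "f x" rule: rev_cases) auto
  show ?thesis
  proof (rule mixed_thin_3I[where f = f and q = "\<lambda>x. butlast (f x)" and c = "\<lambda>x. length (f x)"])
    \<comment> \<open>The last entry of a code is the label of its vertex.\<close>
    show "inj_on f (pverts T)"
      using g code by (metis inj_on_def)
    show "(x, y) \<in> parcs T \<and> (y, x) \<in> parcs T"
      if "x \<in> pverts T" "y \<in> pverts T" "butlast (f y) = f x" for x y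
      using f that arc_sym by (auto simp: path_code_def)
    show "length (f x) = length (f y) \<and> (\<forall>z\<in>pverts T. \<not> (f x < f z \<and> f z < f y)) \<or>
        length (f y) = Suc (length (f x)) \<and> butlast (f y) = f x \<or>
        length (f x) = Suc (length (f y)) \<and> butlast (f x) = f y" if "(x, y) \<in> parcs T" for x y
    proof -
      have xy: "x \<in> pverts T" "y \<in> pverts T" using that in_arcsD1 in_arcsD2 by auto
      then have "butlast (f y) = f x \<or> butlast (f x) = f y"
        using f that by (auto simp: path_code_def)
      then show ?thesis
        using len xy by metis
    qed
  qed (rule butlast_mono_lenlex)
qed

theorem proposition3p3:
  shows "(\<forall>t::nat. 1 \<le> t \<longrightarrow>
            inversion_free_proper_mixed_thin 1 (graph_complement (matching_graph t))) \<and>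
         (\<forall>m n :: nat. 1 \<le> m \<and> 1 \<le> n \<longrightarrow> inversion_free_proper_mixed_thin 3 (grid_graph m n)) \<and>
         (\<forall>T :: 'a pair_pre_digraph. undirected_tree T \<longrightarrow> inversion_free_proper_mixed_thin 3 T)"
  using mixed_thin_matching_complement mixed_thin_grid mixed_thin_tree by blast

end
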